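(* Let $k\ge 1$ and $n\ge k+4$ be integers. The digraphs $\overrightarrow{G}_{n}^{k,2}$ and $\overrightarrow{G}_{n}^{k,n-k-2}$ minimize the distance spectral radius among all digraphs in $\overrightarrow{\mathcal{D}}_{n,k}$; that is, both belong to $\overrightarrow{\mathcal{D}}_{n,k}$ and for every $\overrightarrow{G}\in\overrightarrow{\mathcal{D}}_{n,k}$, $$\lambda_1(D(\overrightarrow{G}))\ \ge\ \lambda_1(D(\overrightarrow{G}_{n}^{k,2}))=\lambda_1(D(\overrightarrow{G}_{n}^{k,n-k-2})).$$
   Context: Digraphs are finite, without loops and without parallel arcs (a pair of opposite arcs $uv$, $vu$ is allowed). A digraph is strongly connected if for every pair of vertices $u,v$ there is a directed path from $u$ to $v$ and a directed path from $v$ to $u$. For a strongly connected digraph $\overrightarrow{G}$ with vertices $v_1,\dots,v_n$, the distance matrix $D(\overrightarrow{G})=(d_{ij})$ has as entry $d_{ij}$ the length of a shortest directed path from $v_i$ to $v_j$; the distance spectral radius $\lambda_1(D(\overrightarrow{G}))$ is the eigenvalue of $D(\overrightarrow{G})$ with largest modulus (the Perron root of this nonnegative irreducible matrix). The essential connectivity $\kappa'(\overrightarrow{G})$ of a strongly connected digraph $\overrightarrow{G}$ is the minimum number of vertices whose removal produces a digraph with at least two non-trivial strongly connected components (non-trivial means containing at least one arc, equivalently at least two vertices). $\overrightarrow{\mathcal{D}}_{n,k}$ is the set of strongly connected digraphs of order $n$ with essential connectivity $\kappa'(\overrightarrow{G})=k$. $\overrightarrow{K}_m$ is the complete digraph of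 order $m$, in which every pair of distinct vertices is connected by a pair of opposite arcs. $\cup$ denotes disjoint union of digraphs. For disjoint digraphs $\overrightarrow{G}_1,\overrightarrow{G}_2$, $\overrightarrow{G}_1\nabla\overrightarrow{G}_2$ is the digraph with vertex set $V(\overrightarrow{G}_1)\cup V(\overrightarrow{G}_2)$ and arc set $E(\overrightarrow{G}_1)\cup E(\overrightarrow{G}_2)\cup\{uv,vu\mid u\in V(\overrightarrow{G}_1),v\in V(\overrightarrow{G}_2)\}$. For $2\le n_1\le n-k-2$, $\overrightarrow{G}_n^{k,n_1}$ is the digraph obtained from $\overrightarrow{K}_k\nabla(\overrightarrow{K}_{n_1}\cup\overrightarrow{K}_{n-k-n_1})$ by adding the set of arcs $F=\{uv\mid u\in V(\overrightarrow{K}_{n_1}),\ v\in V(\overrightarrow{K}_{n-k-n_1})\}$. *)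

theory Defs
  imports
    "Graph_Theory.Kuratowski"
    "Jordan_Normal_Form.Spectral_Radius"
    "HOL-Library.Extended_Nat"
begin

section \<open>Distance spectral radius\<close>

definition directed_dist :: "('a, 'b) pre_digraph \<Rightarrow> 'a \<Rightarrow> 'a \<Rightarrow> nat" where
  "directed_dist G u v = (LEAST l. \<exists>p. pre_digraph.apath G u p v \<and> length p = l)"

definition distance_matrix :: "('a, 'b) pre_digraph \<Rightarrow> 'a list \<Rightarrow> complex mat" where
  "distance_matrix G vs =
     mat (length vs) (length vs) (\<lambda>(i, j). of_nat (directed_dist G (vs ! i) (vs ! j)))"

text \<open>The ordering of the vertices used to write down the distance matrix is an arbitrary one;
  \<open>distance_spectral_radius_eq\<close> below shows that the choice does not matter.\<close>

definition distance_spectral_radius :: "('a, 'b) pre_digraph \<Rightarrow> real" where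
  "distance_spectral_radius G =
     spectral_radius (distance_matrix G (SOME vs. distinct vs \<and> set vs = verts G))"

lemma eigenvalue_distance_matrix_perm:
  assumes "distinct vs" "distinct ws" "set vs = set ws"
    and ev: "eigenvalue (distance_matrix G vs) a"
  shows "eigenvalue (distance_matrix G ws) a"
proof -
  define n where "n = length vs"
  have n: "length ws = n" "length vs = n"
    using assms by (metis n_def distinct_card)+
  have dims: "distance_matrix G vs \<in> carrier_mat n n" "distance_matrix G ws \<in> carrier_mat n n"
    by (simp_all add: distance_matrix_def n)
  have bijv: "bij_betw (\<lambda>i. vs ! i) {..<n} (set vs)"
    using bij_betw_nth[OF assms(1)] n by simp
  have bijw: "bij_betw (\<lambda>i. ws ! i) {..<n} (set vs)"
    using bij_betw_nth[OF assms(2)] n assms(3) by simp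
  define f where "f = (\<lambda>i. the_inv_into {..<n} (\<lambda>i. vs ! i) (ws ! i))"
  have bij: "bij_betw f {..<n} {..<n}"
    using bij_betw_trans[OF bijw bij_betw_the_inv_into[OF bijv]] unfolding f_def comp_def .
  have f_lt: "f i < n" if "i < n" for i
    using bij that by (auto simp: bij_betw_def)
  have f_nth: "vs ! f i = ws ! i" if "i < n" for i
    unfolding f_def using that bijv bijw
    by (intro f_the_inv_into_f_bij_betw) (auto simp: bij_betw_def)
  obtain v where v: "v \<in> carrier_vec n" "v \<noteq> 0\<^sub>v n" "distance_matrix G vs *\<^sub>v v = a \<cdot>\<^sub>v v"
    using ev dims(1) unfolding eigenvalue_def eigenvector_def by auto
  define w where "w = vec n (\<lambda>i. v $ f i)"
  have w: "w \<in> carrier_vec n" by (simp add: w_def)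
  have "w \<noteq> 0\<^sub>v n"
  proof
    assume w0: "w = 0\<^sub>v n"
    have "v $ i = 0" if "i < n" for i
    proof -
      from that bij obtain j where "j < n" "i = f j"
        by (metis bij_betw_imp_surj_on imageE lessThan_iff)
      then show ?thesis using arg_cong[OF w0, of "\<lambda>u. u $ j"] by (simp add: w_def)
    qed
    then have "v = 0\<^sub>v n" using v(1) by (intro eq_vecI) auto
    then show False using v(2) by simp
  qed
  moreover have "distance_matrix G ws *\<^sub>v w = a \<cdot>\<^sub>v w"
  proof (rule eq_vecI)
    fix i assume "i < dim_vec (a \<cdot>\<^sub>v w)"
    then have i: "i < n" by (simp add: w_def)
    have "(distance_matrix G ws *\<^sub>v w) $ i
        = (\<Sum>j\<in>{..<n}. of_nat (directed_dist G (ws ! i) (ws ! j)) * v $ f j)"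
      using i n by (simp add: distance_matrix_def w_def scalar_prod_def lessThan_atLeast0)
    also have "\<dots> = (\<Sum>j\<in>{..<n}. of_nat (directed_dist G (vs ! f i) (vs ! f j)) * v $ f j)"
      using i by (intro sum.cong) (auto simp: f_nth)
    also have "\<dots> = (\<Sum>j\<in>{..<n}. of_nat (directed_dist G (vs ! f i) (vs ! j)) * v $ j)"
      by (rule sum.reindex_bij_betw[OF bij])
    also have "\<dots> = (distance_matrix G vs *\<^sub>v v) $ f i"
      using f_lt[OF i] n v(1) by (simp add: distance_matrix_def scalar_prod_def lessThan_atLeast0)
    also have "\<dots> = (a \<cdot>\<^sub>v w) $ i"
      using f_lt[OF i] i v by (simp add: w_def)
    finally show "(distance_matrix G ws *\<^sub>v w) $ i = (a \<cdot>\<^sub>v w) $ i" .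
  qed (use dims w in auto)
  ultimately show ?thesis
    using w dims unfolding eigenvalue_def eigenvector_def by auto
qed

lemma distance_spectral_radius_eq:
  assumes "distinct vs" "set vs = verts G"
  shows "distance_spectral_radius G = spectral_radius (distance_matrix G vs)"
proof -
  define ws where "ws = (SOME ws. distinct ws \<and> set ws = verts G)"
  have ws: "distinct ws \<and> set ws = verts G"
    unfolding ws_def by (rule someI[of _ vs]) (use assms in auto)
  then have "spectrum (distance_matrix G ws) = spectrum (distance_matrix G vs)"
    using assms eigenvalue_distance_matrix_perm[of ws vs G] eigenvalue_distance_matrix_perm[of vs ws G]
    unfolding spectrum_def by auto
  then show ?thesis
    by (simp add: distance_spectral_radius_def ws_def spectral_radius_def)
qed


section \<open>Essential connectivity\<close>

definition nontrivial_sccs :: "('a, 'b) pre_digraph \<Rightarrow> ('a, 'b) pre_digraph set" where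
  "nontrivial_sccs G = {C \<in> pre_digraph.sccs G. arcs C \<noteq> {}}"

text \<open>The value is \<open>\<infinity>\<close> if no set of vertices has this property, as for complete
  digraphs.\<close>

definition essential_connectivity :: "('a, 'b) pre_digraph \<Rightarrow> enat" where
  "essential_connectivity G =
     (INF S \<in> {S. S \<subseteq> verts G \<and> card (nontrivial_sccs (G \<restriction> (verts G - S))) \<ge> 2}. enat (card S))"

definition essential_class :: "nat \<Rightarrow> nat \<Rightarrow> ('a, 'b) pre_digraph set" where
  "essential_class n k =
     {G. digraph G \<and> strongly_connected G \<and> card (verts G) = n \<and> essential_connectivity G = enat k}"


section \<open>Extremal digraphs\<close>

definition complete_on :: "'a set \<Rightarrow> ('a, 'a \<times> 'a) pre_digraph" where
  "complete_on A = \<lparr> verts = A, arcs = {(u, v). u \<in> A \<and> v \<in> A \<and> u \<noteq> v}, tail = fst, head = snd \<rparr>"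

lemma complete_digraph_complete_on:
  assumes "finite A"
  shows "complete_digraph (card A) (complete_on A)"
proof -
  have "complete_on A = with_proj \<lparr> pverts = A, parcs = {(u, v). u \<in> A \<and> v \<in> A \<and> u \<noteq> v} \<rparr>"
    by (simp add: complete_on_def with_proj_def)
  then show ?thesis
    using assms by (simp add: complete_digraph_pair_def)
qed

definition join :: "('a, 'a \<times> 'a) pre_digraph \<Rightarrow> ('a, 'a \<times> 'a) pre_digraph \<Rightarrow> ('a, 'a \<times> 'a) pre_digraph"
    (infixl \<open>\<nabla>\<close> 65) where
  "G \<nabla> H = \<lparr> verts = verts G \<union> verts H,
     arcs = arcs G \<union> arcs H \<union> verts G \<times> verts H \<union> verts H \<times> verts G, tail = fst, head = snd \<rparr>"

text \<open>The three complete digraphs live on consecutive blocks of \<open>{0..<n}\<close>, so that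
  the plain union is a disjoint one.\<close>

definition extremal_digraph :: "nat \<Rightarrow> nat \<Rightarrow> nat \<Rightarrow> (nat, nat \<times> nat) pre_digraph" where
  "extremal_digraph n k n1 =
     (let A = {0..<k}; B = {k..<k + n1}; C = {k + n1..<n};
          H = complete_on A \<nabla> Digraph_Component.union (complete_on B) (complete_on C)
      in H\<lparr> arcs := arcs H \<union> B \<times> C \<rparr>)"

end

theory Submission
  imports Defs
begin

text \<open>
  If deleting \<open>k\<close> vertices of \<open>G\<close> leaves two nontrivial strong components, say with no path from the
  first to the second, let \<open>R\<close> be the set reachable from the first one and \<open>A\<close> the set of remaining
  vertices. There is no arc from \<open>R\<close> to \<open>A\<close>, so the distance matrix dominates the 0/1/2 matrix in which
  exactly the pairs in \<open>R \<times> A\<close> have distance 2; the extremal digraphs attain it. The vector with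
  entries \<open>t + |A|\<close> on \<open>R\<close> and \<open>t\<close> elsewhere is a positive eigenvector of this matrix for \<open>t - 1\<close>,
  where \<open>t\<^sup>2 = n t + |R| |A|\<close>. Comparing with this vector gives the bound, and since
  \<open>|R| + |A| = n - k\<close> with both at least 2, the product \<open>|R| |A|\<close> is at least \<open>2 (n - k - 2)\<close>.
\<close>

section \<open>Collatz-Wielandt bounds for nonnegative real matrices\<close>

text \<open>If the spectral radius were below \<open>r < \<rho>\<close>, the powers of \<open>B / r\<close> would be bounded, whereas
  they stretch \<open>x\<close> at least by powers of \<open>\<rho> / r\<close>.\<close>

lemma collatz_wielandt_lower:
  fixes B :: "real mat" and x :: "nat \<Rightarrow> real"
  assumes B: "B \<in> carrier_mat n n" and n: "n > 0"
    and nonneg: "\<And>i j. i < n \<Longrightarrow> j < n \<Longrightarrow> 0 \<le> B $$ (i, j)"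
    and x: "\<And>i. i < n \<Longrightarrow> 0 < x i"
    and le: "\<And>i. i < n \<Longrightarrow> \<rho> * x i \<le> (\<Sum>j<n. B $$ (i, j) * x j)"
  shows "\<rho> \<le> spectral_radius (map_mat complex_of_real B)"
proof (rule ccontr)
  let ?A = "map_mat complex_of_real B"
  assume "\<not> ?thesis"
  then obtain r where r: "spectral_radius ?A < r" "r < \<rho>"
    using dense by (auto simp: not_le)
  have A: "?A \<in> carrier_mat n n" using B by simp
  have "0 \<le> spectral_radius ?A"
    using spectral_radius_mem_max(1)[OF A n] by auto
  with r have r0: "r > 0" by simp
  define C where "C = (1 / r) \<cdot>\<^sub>m B"
  have C: "C \<in> carrier_mat n n" using B by (simp add: C_def)
  let ?C = "map_mat complex_of_real C"
  have C': "?C \<in> carrier_mat n n" using C by simp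
  have CA: "?A = complex_of_real r \<cdot>\<^sub>m ?C"
    using B r0 by (intro eq_matI) (auto simp: C_def)
  have C_nth: "C $$ (i, j) = B $$ (i, j) / r" if "i < n" "j < n" for i j
    using that B by (simp add: C_def)
  \<comment> \<open>Multiplying an eigenvalue of \<open>?C\<close> by \<open>r\<close> gives an
    eigenvalue of \<open>?A\<close>, and those have modulus below \<open>r\<close>.\<close>
  have "norm a < 1" if "a \<in> spectrum ?C" for a
  proof -
    from that obtain v where v: "v \<in> carrier_vec n" "v \<noteq> 0\<^sub>v n" "?C *\<^sub>v v = a \<cdot>\<^sub>v v"
      using C unfolding spectrum_def eigenvalue_def eigenvector_def by auto
    have "?A *\<^sub>v v = complex_of_real r \<cdot>\<^sub>v (?C *\<^sub>v v)"
      unfolding CA using C v(1) by (intro eq_vecI) auto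
    also have "\<dots> = (complex_of_real r * a) \<cdot>\<^sub>v v"
      by (simp add: v(3) smult_smult_assoc)
    finally have "complex_of_real r * a \<in> spectrum ?A"
      using v A B unfolding spectrum_def eigenvalue_def eigenvector_def by auto
    then have "norm (complex_of_real r * a) \<le> spectral_radius ?A"
      using spectral_radius_mem_max(2)[OF A n] by blast
    then have "r * norm a \<le> spectral_radius ?A" using r0 by (simp add: norm_mult)
    also note r(1)
    finally show ?thesis using r0 by simp
  qed
  then have "spectral_radius ?C < 1"
    using spectral_radius_mem_max(1)[OF C' n] by auto
  then obtain c where c: "\<And>k. norm_bound (?C ^\<^sub>m k) c"
    using spectral_radius_jnf_norm_bound_less_1_upper_triangular[OF C'] by blast
  have pow: "?C ^\<^sub>m k = map_mat complex_of_real (C ^\<^sub>m k)" for k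
    using C by (metis of_real_hom.mat_hom_pow)
  have Ck: "C ^\<^sub>m k \<in> carrier_mat n n" for k using C by simp
  have bound: "(C ^\<^sub>m k) $$ (i, j) \<le> c" if "i < n" "j < n" for k i j
  proof -
    have "norm ((?C ^\<^sub>m k) $$ (i, j)) \<le> c"
      using c[of k] that C Ck[of k] unfolding norm_bound_def by (auto simp: pow)
    then show ?thesis using that carrier_matD[OF Ck[of k]] by (simp add: pow del: pow_mat_dim_square)
  qed
  define q where "q = \<rho> / r"
  have q: "q > 1" using r r0 by (simp add: q_def)
  have step: "(C ^\<^sub>m Suc k) $$ (i, j) = (\<Sum>l<n. (C ^\<^sub>m k) $$ (i, l) * C $$ (l, j))"
    if "i < n" "j < n" for k i j
    using that C Ck[of k] by (simp add: scalar_prod_def lessThan_atLeast0)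
  \<comment> \<open>Nonnegativity of the powers is carried through the induction because the
    inequality \<open>q * x l \<le> ...\<close> is multiplied by entries of the previous
    power.\<close>
  have grow: "(\<forall>j<n. 0 \<le> (C ^\<^sub>m k) $$ (i, j)) \<and> q ^ k * x i \<le> (\<Sum>j<n. (C ^\<^sub>m k) $$ (i, j) * x j)"
    if i: "i < n" for i k
  proof (induction k)
    case 0
    have "(\<Sum>j<n. (C ^\<^sub>m 0) $$ (i, j) * x j) = (\<Sum>j<n. if j = i then x j else 0)"
      using i C by (intro sum.cong) auto
    also have "\<dots> = x i" using i by simp
    finally show ?case using i C by auto
  next
    case (Suc k)
    then have IH: "\<And>j. j < n \<Longrightarrow> 0 \<le> (C ^\<^sub>m k) $$ (i, j)"
      "q ^ k * x i \<le> (\<Sum>j<n. (C ^\<^sub>m k) $$ (i, j) * x j)" by auto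
    have Cx: "q * x l \<le> (\<Sum>j<n. C $$ (l, j) * x j)" if "l < n" for l
      using le[OF that] that r0
      by (simp add: q_def C_nth sum_divide_distrib[symmetric] divide_right_mono)
    have "q ^ Suc k * x i \<le> q * (\<Sum>l<n. (C ^\<^sub>m k) $$ (i, l) * x l)"
      using mult_left_mono[OF IH(2), of q] q by (simp add: mult.assoc)
    also have "\<dots> = (\<Sum>l<n. (C ^\<^sub>m k) $$ (i, l) * (q * x l))"
      by (simp add: sum_distrib_left mult_ac)
    also have "\<dots> \<le> (\<Sum>l<n. (C ^\<^sub>m k) $$ (i, l) * (\<Sum>j<n. C $$ (l, j) * x j))"
      using IH(1) Cx by (intro sum_mono mult_left_mono) auto
    also have "\<dots> = (\<Sum>l<n. \<Sum>j<n. (C ^\<^sub>m k) $$ (i, l) * C $$ (l, j) * x j)"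
      by (simp add: sum_distrib_left mult.assoc)
    also have "\<dots> = (\<Sum>j<n. \<Sum>l<n. (C ^\<^sub>m k) $$ (i, l) * C $$ (l, j) * x j)"
      by (rule sum.swap)
    also have "\<dots> = (\<Sum>j<n. (C ^\<^sub>m Suc k) $$ (i, j) * x j)"
      using i by (intro sum.cong) (simp_all only: step sum_distrib_right lessThan_iff)
    finally have "q ^ Suc k * x i \<le> (\<Sum>j<n. (C ^\<^sub>m Suc k) $$ (i, j) * x j)" .
    moreover have "0 \<le> (C ^\<^sub>m Suc k) $$ (i, j)" if "j < n" for j
      unfolding step[OF i that] using IH(1) nonneg that r0
      by (intro sum_nonneg mult_nonneg_nonneg) (auto simp: C_nth)
    ultimately show ?case by blast
  qed
  \<comment> \<open>One row suffices; row 0 exists since \<open>n > 0\<close>. The right-hand side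
    is independent of \<open>k\<close>, which contradicts \<open>q > 1\<close>.\<close>
  have "q ^ k \<le> (\<Sum>j<n. c * x j) / x 0" for k
  proof -
    have "q ^ k * x 0 \<le> (\<Sum>j<n. (C ^\<^sub>m k) $$ (0, j) * x j)" using grow[OF n] by blast
    also have "\<dots> \<le> (\<Sum>j<n. c * x j)"
      using bound[OF n] x by (intro sum_mono mult_right_mono) (auto intro: less_imp_le)
    finally show ?thesis using x[OF n] by (simp add: pos_le_divide_eq)
  qed
  then show False using real_arch_pow[OF q] by (meson not_le)
qed

text \<open>Take an eigenvector \<open>v\<close> for an eigenvalue of largest modulus and read the
  eigenvalue equation at an index where the ratio of \<open>norm (v $ i)\<close> to
  \<open>x i\<close> is maximal: there the triangle inequality loses nothing that matters.\<close>

lemma collatz_wielandt_upper: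
  fixes B :: "real mat" and x :: "nat \<Rightarrow> real"
  assumes B: "B \<in> carrier_mat n n" and n: "n > 0"
    and nonneg: "\<And>i j. i < n \<Longrightarrow> j < n \<Longrightarrow> 0 \<le> B $$ (i, j)"
    and x: "\<And>i. i < n \<Longrightarrow> 0 < x i"
    and ge: "\<And>i. i < n \<Longrightarrow> (\<Sum>j<n. B $$ (i, j) * x j) \<le> \<rho> * x i"
  shows "spectral_radius (map_mat complex_of_real B) \<le> \<rho>"
proof -
  let ?A = "map_mat complex_of_real B"
  have A: "?A \<in> carrier_mat n n" using B by simp
  obtain a where a: "a \<in> spectrum ?A" "spectral_radius ?A = norm a"
    using spectral_radius_mem_max(1)[OF A n] by auto
  then obtain v where v: "v \<in> carrier_vec n" "v \<noteq> 0\<^sub>v n" "?A *\<^sub>v v = a \<cdot>\<^sub>v v"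
    using B unfolding spectrum_def eigenvalue_def eigenvector_def by auto
  define f where "f i = norm (v $ i) / x i" for i
  define M where "M = Max (f ` {..<n})"
  have "M \<in> f ` {..<n}" unfolding M_def using n by (intro Max_in) auto
  then obtain i where i: "i < n" "M = f i" by auto
  have M: "norm (v $ j) \<le> M * x j" if "j < n" for j
  proof -
    have "f j \<le> M" unfolding M_def using that by (intro Max_ge) auto
    then show ?thesis using x[OF that] by (simp add: f_def pos_divide_le_eq)
  qed
  have Mi: "norm (v $ i) = M * x i" using x[OF i(1)] by (simp add: i(2) f_def)
  \<comment> \<open>A nonzero entry makes the maximal ratio positive, so \<open>norm (v $ i)\<close>
    can be cancelled at the end.\<close>
  obtain j where "j < n" "v $ j \<noteq> 0"
    using v(1,2) by (metis carrier_vecD eq_vecI index_zero_vec)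
  with M[of j] x[of j] have "M > 0"
    by (smt (verit) mult_nonneg_nonneg mult_nonpos_nonneg zero_less_norm_iff)
  then have vi: "norm (v $ i) > 0" using x[OF i(1)] by (simp add: Mi)
  have "norm a * norm (v $ i) = norm ((?A *\<^sub>v v) $ i)"
    using v i by (simp add: norm_mult)
  also have "\<dots> = norm (\<Sum>j<n. of_real (B $$ (i, j)) * v $ j)"
    using B v(1) i by (simp add: scalar_prod_def lessThan_atLeast0)
  also have "\<dots> \<le> (\<Sum>j<n. B $$ (i, j) * norm (v $ j))"
    using nonneg[OF i(1)] by (intro sum_norm_le) (simp add: norm_mult)
  also have "\<dots> \<le> (\<Sum>j<n. B $$ (i, j) * (M * x j))"
    using nonneg[OF i(1)] M by (intro sum_mono mult_left_mono) auto
  also have "\<dots> = M * (\<Sum>j<n. B $$ (i, j) * x j)"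
    by (simp add: sum_distrib_left mult_ac)
  also have "\<dots> \<le> M * (\<rho> * x i)"
    using ge[OF i(1)] \<open>M > 0\<close> by (intro mult_left_mono) auto
  finally have "norm a * norm (v $ i) \<le> \<rho> * norm (v $ i)" by (simp add: Mi mult_ac)
  then show ?thesis using vi a(2) by simp
qed

text \<open>Bridge from matrices to digraphs: the complex distance matrix is the image of a real
  nonnegative one, and its row sums weighted by \<open>x\<close> become sums over vertices. With it,
  both Collatz-Wielandt bounds can be used without choosing an ordering of the vertices.\<close>

lemma distance_spectral_radius_enum:
  fixes x :: "'a \<Rightarrow> real"
  assumes "finite (verts G)" "verts G \<noteq> {}"
  obtains n B and f :: "nat \<Rightarrow> 'a" where "n > 0" "bij_betw f {..<n} (verts G)"
    "B \<in> carrier_mat n n"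
    "\<And>i j. i < n \<Longrightarrow> j < n \<Longrightarrow> 0 \<le> B $$ (i, j)"
    "\<And>i. i < n \<Longrightarrow> (\<Sum>j<n. B $$ (i, j) * x (f j)) = (\<Sum>v\<in>verts G. real (directed_dist G (f i) v) * x v)"
    "distance_spectral_radius G = spectral_radius (map_mat complex_of_real B)"
proof -
  obtain vs where vs: "set vs = verts G" "distinct vs"
    using finite_distinct_list[OF assms(1)] by blast
  define n where "n = length vs"
  define B where "B = mat n n (\<lambda>(i, j). real (directed_dist G (vs ! i) (vs ! j)))"
  have bij: "bij_betw ((!) vs) {..<n} (verts G)"
    using bij_betw_nth[OF vs(2)] vs(1) by (simp add: n_def)
  have "distance_matrix G vs = map_mat complex_of_real B"
    by (intro eq_matI) (auto simp: distance_matrix_def B_def n_def)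
  then have "distance_spectral_radius G = spectral_radius (map_mat complex_of_real B)"
    using distance_spectral_radius_eq[of vs G] vs by simp
  moreover have "(\<Sum>j<n. B $$ (i, j) * x (vs ! j)) = (\<Sum>v\<in>verts G. real (directed_dist G (vs ! i) v) * x v)"
    if "i < n" for i
    using sum.reindex_bij_betw[OF bij, of "\<lambda>v. real (directed_dist G (vs ! i) v) * x v"] that
    by (simp add: B_def)
  moreover have "n > 0" using vs assms(2) by (auto simp: n_def)
  ultimately show ?thesis
    using bij by (intro that[of n "(!) vs" B]) (simp_all add: B_def)
qed

lemma distance_spectral_radius_ge:
  fixes x :: "'a \<Rightarrow> real"
  assumes "finite (verts G)" "verts G \<noteq> {}"
    and x: "\<And>u. u \<in> verts G \<Longrightarrow> 0 < x u"
    and le: "\<And>u. u \<in> verts G \<Longrightarrow> \<rho> * x u \<le> (\<Sum>v\<in>verts G. real (directed_dist G u v) * x v)"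
  shows "\<rho> \<le> distance_spectral_radius G"
proof (rule distance_spectral_radius_enum[OF assms(1,2), of x])
  fix n B f
  assume n: "n > 0" and f: "bij_betw f {..<n} (verts G)" and B: "B \<in> carrier_mat n n"
    "\<And>i j. i < n \<Longrightarrow> j < n \<Longrightarrow> 0 \<le> B $$ (i, j)"
    "\<And>i. i < n \<Longrightarrow> (\<Sum>j<n. B $$ (i, j) * x (f j)) = (\<Sum>v\<in>verts G. real (directed_dist G (f i) v) * x v)"
    and eq: "distance_spectral_radius G = spectral_radius (map_mat complex_of_real B)"
  have "f i \<in> verts G" if "i < n" for i
    using bij_betwE[OF f] that by blast
  then show ?thesis unfolding eq
    using x le by (intro collatz_wielandt_lower[OF B(1) n B(2), of "\<lambda>i. x (f i)"]) (auto simp: B(3))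
qed

lemma distance_spectral_radius_le:
  fixes x :: "'a \<Rightarrow> real"
  assumes "finite (verts G)" "verts G \<noteq> {}"
    and x: "\<And>u. u \<in> verts G \<Longrightarrow> 0 < x u"
    and ge: "\<And>u. u \<in> verts G \<Longrightarrow> (\<Sum>v\<in>verts G. real (directed_dist G u v) * x v) \<le> \<rho> * x u"
  shows "distance_spectral_radius G \<le> \<rho>"
proof (rule distance_spectral_radius_enum[OF assms(1,2), of x])
  fix n B f
  assume n: "n > 0" and f: "bij_betw f {..<n} (verts G)" and B: "B \<in> carrier_mat n n"
    "\<And>i j. i < n \<Longrightarrow> j < n \<Longrightarrow> 0 \<le> B $$ (i, j)"
    "\<And>i. i < n \<Longrightarrow> (\<Sum>j<n. B $$ (i, j) * x (f j)) = (\<Sum>v\<in>verts G. real (directed_dist G (f i) v) * x v)"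
    and eq: "distance_spectral_radius G = spectral_radius (map_mat complex_of_real B)"
  have "f i \<in> verts G" if "i < n" for i
    using bij_betwE[OF f] that by blast
  then show ?thesis unfolding eq
    using x ge by (intro collatz_wielandt_upper[OF B(1) n B(2), of "\<lambda>i. x (f i)"]) (auto simp: B(3))
qed

section \<open>The Perron eigenvector of the 0/1/2 matrix\<close>

text \<open>The largest root of \<open>t\<^sup>2 = n t + m\<close>.\<close>

definition quad_root :: "real \<Rightarrow> real \<Rightarrow> real" where
  "quad_root n m = (n + sqrt (n\<^sup>2 + 4 * m)) / 2"

lemma quad_root_square:
  assumes "0 \<le> m"
  shows "quad_root n m * quad_root n m = n * quad_root n m + m"
proof -
  have "sqrt (n\<^sup>2 + 4 * m) * sqrt (n\<^sup>2 + 4 * m) = n\<^sup>2 + 4 * m"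
    using assms by simp
  then show ?thesis unfolding quad_root_def by (simp add: field_simps power2_eq_square)
qed

lemma quad_root_pos: "0 < n \<Longrightarrow> 0 \<le> m \<Longrightarrow> 0 < quad_root n m"
  by (simp add: quad_root_def add_pos_nonneg)

lemma quad_root_mono: "m \<le> m' \<Longrightarrow> quad_root n m \<le> quad_root n m'"
  by (simp add: quad_root_def)

definition cut_dist :: "'a set \<Rightarrow> 'a set \<Rightarrow> 'a \<Rightarrow> 'a \<Rightarrow> nat" where
  "cut_dist R A u v = (if u = v then 0 else if u \<in> R \<and> v \<in> A then 2 else 1)"

text \<open>The weights of \<open>x\<close> add up to \<open>card V * t + card R * card A\<close>,
  which is \<open>t * t\<close> by the choice of \<open>t\<close>. A row outside \<open>R\<close>
  therefore gives \<open>t * t - t\<close>; a row in \<open>R\<close> gains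
  \<open>card A * t\<close> from the entries 2, and \<open>t * t + card A * t\<close> is
  \<open>t * x u\<close>.\<close>

lemma cut_dist_eigenvector:
  assumes fin: "finite V" and sub: "A \<subseteq> V" "R \<subseteq> V" "A \<inter> R = {}" and u: "u \<in> V"
  defines "t \<equiv> quad_root (real (card V)) (real (card R * card A))"
  defines "x \<equiv> \<lambda>v. if v \<in> R then t + real (card A) else t"
  shows "(\<Sum>v\<in>V. real (cut_dist R A u v) * x v) = (t - 1) * x u"
proof -
  have t2: "t * t = real (card V) * t + real (card R) * real (card A)"
    unfolding t_def by (subst quad_root_square) auto
  have "sum x V = (\<Sum>v\<in>V. t + (if v \<in> R then real (card A) else 0))"
    by (intro sum.cong) (auto simp: x_def)
  also have "\<dots> = t * t"
    using fin sub(2) by (simp add: sum.distrib sum.If_cases Int_absorb1 t2)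
  finally have sV: "sum x V = t * t" .
  have "sum x A = (\<Sum>v\<in>A. t)"
    using sub(3) by (intro sum.cong) (auto simp: x_def)
  then have sA: "sum x A = real (card A) * t" by simp
  \<comment> \<open>The matrix is the all-ones matrix minus the identity plus the indicator of
    \<open>R\<close> times \<open>A\<close>; disjointness keeps that indicator off the
    diagonal.\<close>
  have "(\<Sum>v\<in>V. real (cut_dist R A u v) * x v)
      = (\<Sum>v\<in>V. x v - (if v = u then x v else 0) + (if u \<in> R then (if v \<in> A then x v else 0) else 0))"
    using sub(3) by (intro sum.cong) (auto simp: cut_dist_def)
  also have "\<dots> = sum x V - x u + (if u \<in> R then sum x A else 0)"
    using fin sub(1) u by (simp add: sum.distrib sum_subtractf sum.If_cases Int_absorb1)
  also have "\<dots> = (t - 1) * x u"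
    unfolding sV sA by (simp add: x_def algebra_simps)
  finally show ?thesis .
qed

section \<open>Directed distances and the spectral bound from a cut\<close>

context wf_digraph
begin

lemma directed_dist_apath:
  assumes "u \<rightarrow>\<^sup>* v"
  obtains p where "apath u p v" "length p = directed_dist G u v"
proof -
  from assms have "\<exists>l p. apath u p v \<and> length p = l" by (simp add: reachable_apath)
  from LeastI_ex[OF this] show ?thesis
    using that unfolding directed_dist_def by blast
qed

lemma directed_dist_le: "apath u p v \<Longrightarrow> directed_dist G u v \<le> length p"
  unfolding directed_dist_def by (rule Least_le) blast

text \<open>Inspect a shortest path: without arcs its ends coincide, a single arc cannot lead from
  \<open>R\<close> to \<open>A\<close>, and two arcs already reach the largest value of
  \<open>cut_dist\<close>. Reachability matters, as \<open>directed_dist\<close> is a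
  \<open>LEAST\<close> that is meaningful only when a path exists.\<close>

lemma cut_dist_le_directed_dist:
  assumes "u \<rightarrow>\<^sup>* v" and no: "\<And>a b. a \<in> R \<Longrightarrow> b \<in> A \<Longrightarrow> \<not> a \<rightarrow>\<^bsub>G\<^esub> b"
  shows "cut_dist R A u v \<le> directed_dist G u v"
proof -
  obtain p where p: "apath u p v" "length p = directed_dist G u v"
    using directed_dist_apath[OF assms(1)] .
  show ?thesis
  proof (cases p)
    case Nil
    then show ?thesis using p by (auto simp: apath_Nil_iff cut_dist_def)
  next
    case (Cons e es)
    show ?thesis
    proof (cases es)
      case Nil
      then have "u \<rightarrow> v"
        using p Cons by (auto simp: apath_simps dest: in_arcs_imp_in_arcs_ends)
      then show ?thesis using no[of u v] p(2) Cons by (auto simp: cut_dist_def)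
    next
      case (Cons e' es')
      then show ?thesis using p(2) \<open>p = e # es\<close> by (simp add: cut_dist_def)
    qed
  qed
qed

lemma directed_dist_self:
  "u \<in> verts G \<Longrightarrow> directed_dist G u u = 0"
  using directed_dist_le[of u "[]" u] by (simp add: apath_Nil_iff)

lemma directed_dist_adj:
  assumes "u \<rightarrow> v" "u \<noteq> v" shows "directed_dist G u v \<le> 1"
proof -
  from assms(1) obtain e where e: "e \<in> arcs G" "tail G e = u" "head G e = v" ..
  then have "apath u [e] v" using assms(2) by (auto simp: apath_simps)
  from directed_dist_le[OF this] show ?thesis by simp
qed

lemma directed_dist_two:
  assumes "u \<rightarrow> w" "w \<rightarrow> v" "u \<noteq> v" "u \<noteq> w" "w \<noteq> v" shows "directed_dist G u v \<le> 2"
proof -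
  from assms(1) obtain e where e: "e \<in> arcs G" "tail G e = u" "head G e = w" ..
  from assms(2) obtain f where f: "f \<in> arcs G" "tail G f = w" "head G f = v" ..
  have "apath u [e, f] v" using e f assms(3-5) by (auto simp: apath_simps)
  from directed_dist_le[OF this] show ?thesis by simp
qed

end

text \<open>The eigenvector of the \<open>cut_dist\<close> matrix is positive, so replacing that
  matrix by the larger distance matrix turns its eigenvalue equation into the inequality required by
  the lower Collatz-Wielandt bound.\<close>

lemma distance_spectral_radius_cut:
  assumes "fin_digraph G" "strongly_connected G"
    and sub: "A \<subseteq> verts G" "R \<subseteq> verts G" "A \<inter> R = {}"
    and no: "\<And>a b. a \<in> R \<Longrightarrow> b \<in> A \<Longrightarrow> \<not> a \<rightarrow>\<^bsub>G\<^esub> b"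
  shows "quad_root (real (card (verts G))) (real (card R * card A)) - 1 \<le> distance_spectral_radius G"
proof -
  interpret fin_digraph G by fact
  have ne: "verts G \<noteq> {}" and reach: "\<And>u v. u \<in> verts G \<Longrightarrow> v \<in> verts G \<Longrightarrow> u \<rightarrow>\<^sup>*\<^bsub>G\<^esub> v"
    using assms(2) by (auto simp: strongly_connected_def)
  define t where "t = quad_root (real (card (verts G))) (real (card R * card A))"
  define x where "x = (\<lambda>v. if v \<in> R then t + real (card A) else t)"
  have "0 < t"
    unfolding t_def using ne by (intro quad_root_pos) (auto simp: card_gt_0_iff)
  then have x: "0 < x v" for v by (simp add: x_def add_pos_nonneg)
  have "(t - 1) * x u \<le> (\<Sum>v\<in>verts G. real (directed_dist G u v) * x v)"
    if u: "u \<in> verts G" for u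
  proof -
    have "(t - 1) * x u = (\<Sum>v\<in>verts G. real (cut_dist R A u v) * x v)"
      using cut_dist_eigenvector[OF finite_verts sub u] unfolding t_def x_def by simp
    also have "\<dots> \<le> (\<Sum>v\<in>verts G. real (directed_dist G u v) * x v)"
      using cut_dist_le_directed_dist[OF reach[OF u] no] x
      by (intro sum_mono mult_right_mono) (auto intro: less_imp_le)
    finally show ?thesis .
  qed
  then show ?thesis
    unfolding t_def[symmetric] using ne x by (intro distance_spectral_radius_ge[of G x]) auto
qed

text \<open>When the distances do not exceed \<open>cut_dist\<close> either, the same positive
  vector serves in the upper Collatz-Wielandt bound.\<close>

lemma distance_spectral_radius_cut_eq:
  assumes "fin_digraph G" "strongly_connected G"
    and sub: "A \<subseteq> verts G" "R \<subseteq> verts G" "A \<inter> R = {}"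
    and no: "\<And>a b. a \<in> R \<Longrightarrow> b \<in> A \<Longrightarrow> \<not> a \<rightarrow>\<^bsub>G\<^esub> b"
    and le: "\<And>u v. u \<in> verts G \<Longrightarrow> v \<in> verts G \<Longrightarrow> directed_dist G u v \<le> cut_dist R A u v"
  shows "distance_spectral_radius G = quad_root (real (card (verts G))) (real (card R * card A)) - 1"
proof (rule antisym)
  interpret fin_digraph G by fact
  have ne: "verts G \<noteq> {}"
    using assms(2) by (auto simp: strongly_connected_def)
  define t where "t = quad_root (real (card (verts G))) (real (card R * card A))"
  define x where "x = (\<lambda>v. if v \<in> R then t + real (card A) else t)"
  have "0 < t"
    unfolding t_def using ne by (intro quad_root_pos) (auto simp: card_gt_0_iff)
  then have x: "0 < x v" for v by (simp add: x_def add_pos_nonneg)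
  have "(\<Sum>v\<in>verts G. real (directed_dist G u v) * x v) \<le> (t - 1) * x u"
    if u: "u \<in> verts G" for u
  proof -
    have "(\<Sum>v\<in>verts G. real (directed_dist G u v) * x v) \<le> (\<Sum>v\<in>verts G. real (cut_dist R A u v) * x v)"
      using le[OF u] x by (intro sum_mono mult_right_mono) (auto intro: less_imp_le)
    also have "\<dots> = (t - 1) * x u"
      using cut_dist_eigenvector[OF finite_verts sub u] unfolding t_def x_def by simp
    finally show ?thesis .
  qed
  then show "distance_spectral_radius G \<le> quad_root (real (card (verts G))) (real (card R * card A)) - 1"
    unfolding t_def[symmetric] using ne x by (intro distance_spectral_radius_le[of G x]) auto
qed (rule distance_spectral_radius_cut[OF assms(1-6)])


section \<open>From essential connectivity to a cut\<close>

text \<open>Of two distinct strong components, at least one does not reach the other. The vertices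
  reachable from it form \<open>R\<close>, which no arc leaves; the other component stays in the
  complement \<open>A\<close>.\<close>

lemma (in digraph) nontrivial_sccs_cut:
  assumes "card (nontrivial_sccs G) \<ge> 2"
  obtains A R where "verts G = A \<union> R" "A \<inter> R = {}" "card A \<ge> 2" "card R \<ge> 2"
    "\<And>a b. a \<in> R \<Longrightarrow> b \<in> A \<Longrightarrow> \<not> a \<rightarrow> b"
proof -
  \<comment> \<open>An arc of the component has two distinct ends, since loops are excluded.\<close>
  have card_scc: "card (verts C) \<ge> 2" if C: "C \<in> nontrivial_sccs G" for C
  proof -
    from C obtain e where "e \<in> arcs C" "induced_subgraph C G"
      by (auto simp: nontrivial_sccs_def)
    then have e: "e \<in> arcs G" "{tail G e, head G e} \<subseteq> verts C"
      and sub: "verts C \<subseteq> verts G"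
      by (auto simp: induced_subgraph_def subgraph_def)
    have "card {tail G e, head G e} \<le> card (verts C)"
      using e(2) sub by (intro card_mono) (auto intro: finite_subset)
    then show ?thesis using no_loops[OF e(1)] by simp
  qed
  obtain C D where CD: "C \<in> nontrivial_sccs G" "D \<in> nontrivial_sccs G" "C \<noteq> D"
    using assms by (metis card_le_Suc0_iff_eq card.infinite not_less_eq_eq numeral_2_eq_2 zero_le)
  then have "verts C \<in> sccs_verts" "verts D \<in> sccs_verts"
    by (auto simp: sccs_verts_conv nontrivial_sccs_def)
  moreover have "verts C \<noteq> verts D"
    using inj_on_verts_sccs CD by (auto simp: nontrivial_sccs_def inj_on_def)
  ultimately obtain X Y where XY: "X \<in> verts ` nontrivial_sccs G" "Y \<in> verts ` nontrivial_sccs G"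
    and scc: "X \<in> sccs_verts" "Y \<in> sccs_verts"
    and unreach: "\<And>u v. u \<in> X \<Longrightarrow> v \<in> Y \<Longrightarrow> \<not> u \<rightarrow>\<^sup>* v"
  proof -
    let ?C = "verts C" and ?D = "verts D"
    have s: "?C \<in> sccs_verts" "?D \<in> sccs_verts" by fact+
    have dis: "?C \<inter> ?D = {}" using sccs_verts_disjoint s \<open>?C \<noteq> ?D\<close> by blast
    show ?thesis
    proof (cases "\<exists>u\<in>?C. \<exists>v\<in>?D. u \<rightarrow>\<^sup>* v")
      case True
      then obtain u v where uv: "u \<in> ?C" "v \<in> ?D" "u \<rightarrow>\<^sup>* v" by blast
      have "\<not> d \<rightarrow>\<^sup>* c" if "d \<in> ?D" "c \<in> ?C" for c d
      proof
        \<comment> \<open>Reachability in both directions would close the cycle \<open>u\<close>,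
          \<open>v\<close>, \<open>d\<close>, \<open>c\<close>, \<open>u\<close> and put
          \<open>v\<close> into the component of \<open>u\<close>.\<close>
        assume "d \<rightarrow>\<^sup>* c"
        have "v \<rightarrow>\<^sup>* d" "c \<rightarrow>\<^sup>* u" using s uv that by (auto simp: in_sccs_verts_conv_reachable)
        with \<open>d \<rightarrow>\<^sup>* c\<close> have "v \<rightarrow>\<^sup>* u" by (blast intro: reachable_trans)
        moreover have "v \<notin> ?C" using dis uv by blast
        ultimately show False using s(1) uv by (auto simp: in_sccs_verts_conv_reachable)
      qed
      then show ?thesis using that[of ?D ?C] s CD by blast
    next
      case False
      then show ?thesis using that[of ?C ?D] s CD by blast
    qed
  qed
  define R where "R = {v. \<exists>u\<in>X. u \<rightarrow>\<^sup>* v}"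
  have RV: "R \<subseteq> verts G" by (auto simp: R_def dest: reachable_in_verts)
  have XR: "X \<subseteq> R" using sccs_verts_subsets[OF scc(1)] by (auto simp: R_def)
  have YA: "Y \<subseteq> verts G - R" using sccs_verts_subsets[OF scc(2)] unreach by (auto simp: R_def)
  have "card X \<ge> 2" "card Y \<ge> 2" using XY card_scc by auto
  moreover have "card X \<le> card R" "card Y \<le> card (verts G - R)"
    using XR YA RV by (auto intro!: card_mono intro: finite_subset)
  ultimately have "card R \<ge> 2" "card (verts G - R) \<ge> 2" by auto
  moreover have "\<not> a \<rightarrow> b" if "a \<in> R" "b \<in> verts G - R" for a b
    using that reachable_adj_trans unfolding R_def by blast
  ultimately show ?thesis using RV by (intro that[of "verts G - R" R]) auto
qed

text \<open>A finite value excludes the infimum over the empty set, and a nonempty set of extended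
  naturals attains its infimum.\<close>

lemma essential_connectivity_witness:
  assumes "essential_connectivity G = enat k"
  obtains S where "S \<subseteq> verts G" "card S = k" "card (nontrivial_sccs (G \<restriction> (verts G - S))) \<ge> 2"
proof -
  let ?\<S> = "{S. S \<subseteq> verts G \<and> card (nontrivial_sccs (G \<restriction> (verts G - S))) \<ge> 2}"
  have "?\<S> \<noteq> {}"
  proof
    assume "?\<S> = {}"
    then have "essential_connectivity G = \<infinity>"
      unfolding essential_connectivity_def by (simp only: image_empty Inf_enat_def simp_thms if_True)
    then show False using assms by simp
  qed
  then have "Inf ((\<lambda>S. enat (card S)) ` ?\<S>) \<in> (\<lambda>S. enat (card S)) ` ?\<S>"
    unfolding Inf_enat_def by (simp only: image_is_empty if_False) (rule LeastI_ex, blast)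
  then show ?thesis using assms that unfolding essential_connectivity_def by auto
qed

text \<open>The difference of the two sides is \<open>(p - 2) * (q - 2)\<close>.\<close>

lemma two_mult_le_mult_of_sum:
  fixes p q m :: nat
  assumes "p + q = m" "p \<ge> 2" "q \<ge> 2"
  shows "2 * (m - 2) \<le> p * q"
proof -
  obtain a b where "p = a + 2" "q = b + 2" using assms by (metis add.commute le_Suc_ex)
  then show ?thesis using assms(1) by (auto simp: algebra_simps)
qed

text \<open>A minimum separating set leaves \<open>n - k\<close> vertices, split into
  \<open>R\<close> and \<open>A\<close> of size at least 2 each; the cut bound grows with the
  product of the sizes, which is smallest when one of them is 2.\<close>

lemma essential_class_spectral_radius_ge:
  assumes "G \<in> essential_class n k"
  shows "quad_root (real n) (real (2 * (n - k - 2))) - 1 \<le> distance_spectral_radius G"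
proof -
  from assms interpret digraph G by (simp add: essential_class_def)
  from assms have sc: "strongly_connected G" and n: "card (verts G) = n"
    and ec: "essential_connectivity G = enat k" by (auto simp: essential_class_def)
  obtain S where S: "S \<subseteq> verts G" "card S = k" "card (nontrivial_sccs (G \<restriction> (verts G - S))) \<ge> 2"
    using essential_connectivity_witness[OF ec] .
  let ?H = "G \<restriction> (verts G - S)"
  have "subgraph ?H G" by (intro induced_imp_subgraph induced_induce) blast
  then interpret H: digraph ?H by (rule digraph_subgraph)
  obtain A R where AR: "verts G - S = A \<union> R" "A \<inter> R = {}" "card A \<ge> 2" "card R \<ge> 2"
    and no: "\<And>a b. a \<in> R \<Longrightarrow> b \<in> A \<Longrightarrow> \<not> a \<rightarrow>\<^bsub>?H\<^esub> b"
    using H.nontrivial_sccs_cut[OF S(3)] by auto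
  \<comment> \<open>Both ends survive the deletion of \<open>S\<close>, so an arc of
    \<open>G\<close> between them would also be an arc of \<open>?H\<close>.\<close>
  have no': "\<not> a \<rightarrow>\<^bsub>G\<^esub> b" if "a \<in> R" "b \<in> A" for a b
    using no[OF that] that AR(1) by (fastforce simp: arcs_ends_conv)
  have sub: "A \<subseteq> verts G" "R \<subseteq> verts G" using AR(1) by auto
  have "card R + card A = card (verts G - S)"
    using AR(1,2) sub by (metis add.commute card_Un_disjoint finite_subset finite_verts)
  also have "\<dots> = n - k" using S n by (simp add: card_Diff_subset finite_subset[OF S(1)])
  finally have "2 * (n - k - 2) \<le> card R * card A"
    using AR(3,4) by (intro two_mult_le_mult_of_sum)
  then have "quad_root (real n) (real (2 * (n - k - 2))) \<le> quad_root (real n) (real (card R * card A))"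
    by (intro quad_root_mono) (simp only: of_nat_le_iff)
  also have "\<dots> - 1 \<le> distance_spectral_radius G"
    using distance_spectral_radius_cut[OF fin_digraph_axioms sc sub AR(2) no'] n by simp
  finally show ?thesis by simp
qed

section \<open>The extremal digraphs\<close>

context
  fixes n k n1 :: nat
begin

abbreviation (input) "E \<equiv> extremal_digraph n k n1"

text \<open>Seen from the complement: on the blocks \<open>A\<close>, \<open>B\<close>,
  \<open>C\<close> of the definition, the digraph is complete except that all arcs from
  \<open>C\<close> to \<open>B\<close> are missing.\<close>

lemma extremal_simps:
  assumes "k + n1 \<le> n"
  shows "verts E = {0..<n}" "tail E = fst" "head E = snd"
    "arcs E = {(u, v). u < n \<and> v < n \<and> u \<noteq> v \<and> \<not> (k + n1 \<le> u \<and> k \<le> v \<and> v < k + n1)}"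
  using assms
  by (auto simp: extremal_digraph_def Let_def join_def complete_on_def Digraph_Component.union_def)

lemma extremal_adj:
  assumes "k + n1 \<le> n"
  shows "u \<rightarrow>\<^bsub>E\<^esub> v \<longleftrightarrow> u < n \<and> v < n \<and> u \<noteq> v \<and> \<not> (k + n1 \<le> u \<and> k \<le> v \<and> v < k + n1)"
  by (auto simp: arcs_ends_conv extremal_simps[OF assms] image_iff)

lemma digraph_extremal:
  assumes "k + n1 \<le> n"
  shows "digraph E"
proof
  have "arcs E \<subseteq> {0..<n} \<times> {0..<n}" by (auto simp: extremal_simps[OF assms])
  then show "finite (arcs E)" by (rule finite_subset) simp
qed (auto simp: extremal_simps[OF assms] arc_to_ends_def)

text \<open>A vertex \<open>w\<close> of the first block is joined in both directions to every other
  vertex, so all paths can be routed through it.\<close>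

lemma strongly_connected_extremal_induce:
  assumes "k + n1 \<le> n" "w < k" "w \<in> U" "U \<subseteq> {0..<n}"
  shows "strongly_connected (E \<restriction> U)"
proof
  interpret digraph E by (rule digraph_extremal) fact
  interpret H: wf_digraph "E \<restriction> U" by (rule wellformed_induce_subgraph)
  have adj: "u \<rightarrow>\<^bsub>E \<restriction> U\<^esub> v" if "u \<in> U" "v \<in> U" "u \<rightarrow>\<^bsub>E\<^esub> v" for u v
    using that by (force simp: arcs_ends_conv)
  fix u v assume "u \<in> verts (E \<restriction> U)" "v \<in> verts (E \<restriction> U)"
  then have uv: "u \<in> U" "v \<in> U" by auto
  have "u \<rightarrow>\<^sup>*\<^bsub>E \<restriction> U\<^esub> w"
  proof (cases "u = w")
    case False
    then show ?thesis using assms uv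
      by (intro H.reachable_adjI adj) (auto simp: extremal_adj)
  qed (use uv in auto)
  moreover have "w \<rightarrow>\<^sup>*\<^bsub>E \<restriction> U\<^esub> v"
  proof (cases "v = w")
    case False
    then show ?thesis using assms uv
      by (intro H.reachable_adjI adj) (auto simp: extremal_adj)
  qed (use uv in auto)
  ultimately show "u \<rightarrow>\<^sup>*\<^bsub>E \<restriction> U\<^esub> v" by (rule H.reachable_trans)
qed (use assms in auto)

lemma strongly_connected_extremal:
  assumes "k \<ge> 1" "k + n1 \<le> n"
  shows "strongly_connected E"
proof -
  have "E \<restriction> {0..<n} = E"
    using assms by (auto simp: induce_subgraph_def extremal_simps intro!: pre_digraph.equality)
  then show ?thesis using strongly_connected_extremal_induce[of 0 "{0..<n}"] assms by simp
qed

text \<open>Without the first block, two complete blocks remain, with arcs between them in one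
  direction only; each is a strong component.\<close>

lemma card_nontrivial_sccs_extremal:
  assumes "k + n1 + 2 \<le> n" "n1 \<ge> 2"
  shows "card (nontrivial_sccs (E \<restriction> {k..<n})) \<ge> 2"
proof -
  have kn: "k + n1 \<le> n" using assms by simp
  interpret digraph E by (rule digraph_extremal) fact
  let ?H = "E \<restriction> {k..<n}" and ?B = "{k..<k + n1}" and ?C = "{k + n1..<n}"
  have "subgraph ?H E"
    by (intro induced_imp_subgraph induced_induce) (auto simp: extremal_simps[OF kn])
  then interpret H: digraph ?H by (rule digraph_subgraph)
  have adj: "u \<rightarrow>\<^bsub>?H\<^esub> v \<longleftrightarrow> u \<in> {k..<n} \<and> v \<in> {k..<n} \<and> u \<noteq> v \<and> \<not> (u \<in> ?C \<and> v \<in> ?B)" for u v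
    using kn by (auto simp: arcs_ends_conv extremal_simps[OF kn] image_iff)
  \<comment> \<open>No arc of \<open>?H\<close> leaves \<open>?C\<close>, hence no path
    does.\<close>
  have stay: "v \<in> ?C" if "u \<rightarrow>\<^sup>*\<^bsub>?H\<^esub> v" "u \<in> ?C" for u v
    using that by (induction rule: H.reachable_induct) (auto simp: adj)
  have reach: "u \<rightarrow>\<^sup>*\<^bsub>?H\<^esub> v" if "u \<in> {k..<n}" "v \<in> {k..<n}" "\<not> (u \<in> ?C \<and> v \<in> ?B)" for u v
  proof (cases "u = v")
    case False
    then show ?thesis using that adj by (intro H.reachable_adjI) blast
  qed (use that in simp)
  have V: "v \<in> {k..<n}" if "u \<rightarrow>\<^sup>*\<^bsub>?H\<^esub> v" for u v
    using H.reachable_in_verts(2)[OF that] by simp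
  have "?B \<in> H.sccs_verts"
    unfolding H.in_sccs_verts_conv_reachable
  proof (intro conjI ballI allI impI)
    fix u v assume "u \<in> ?B" "v \<in> ?B"
    then show "u \<rightarrow>\<^sup>*\<^bsub>?H\<^esub> v" using kn by (intro reach) auto
  next
    fix u v assume uv: "u \<in> ?B" "v \<notin> ?B"
    show "\<not> u \<rightarrow>\<^sup>*\<^bsub>?H\<^esub> v \<or> \<not> v \<rightarrow>\<^sup>*\<^bsub>?H\<^esub> u"
      using uv V[of u v] stay[of v u] by auto
  qed (use assms in auto)
  moreover have "?C \<in> H.sccs_verts"
    unfolding H.in_sccs_verts_conv_reachable
  proof (intro conjI ballI allI impI)
    fix u v assume "u \<in> ?C" "v \<in> ?C"
    then show "u \<rightarrow>\<^sup>*\<^bsub>?H\<^esub> v" by (intro reach) auto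
  next
    fix u v assume uv: "u \<in> ?C" "v \<notin> ?C"
    then show "\<not> u \<rightarrow>\<^sup>*\<^bsub>?H\<^esub> v \<or> \<not> v \<rightarrow>\<^sup>*\<^bsub>?H\<^esub> u"
      using stay[of u v] by auto
  qed (use assms in auto)
  ultimately have "{?H \<restriction> ?B, ?H \<restriction> ?C} \<subseteq> H.sccs"
    by (simp add: H.in_sccs_verts_conv)
  \<comment> \<open>Each block has at least two vertices, hence an arc; this is where
    \<open>n1 \<ge> 2\<close> and \<open>k + n1 + 2 \<le> n\<close> enter.\<close>
  moreover have "(k, k + 1) \<in> arcs (?H \<restriction> ?B)" "(k + n1, k + n1 + 1) \<in> arcs (?H \<restriction> ?C)"
    using assms by (auto simp: extremal_simps[OF kn])
  ultimately have "{?H \<restriction> ?B, ?H \<restriction> ?C} \<subseteq> nontrivial_sccs ?H"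
    unfolding nontrivial_sccs_def by blast
  moreover have "finite (nontrivial_sccs ?H)"
    using H.finite_sccs_verts unfolding nontrivial_sccs_def H.sccs_conv_sccs_verts by simp
  ultimately have "card {?H \<restriction> ?B, ?H \<restriction> ?C} \<le> card (nontrivial_sccs ?H)"
    by (intro card_mono)
  moreover have "verts (?H \<restriction> ?B) \<noteq> verts (?H \<restriction> ?C)"
    using assms by (auto simp: set_eq_iff intro!: exI[of _ k])
  then have "?H \<restriction> ?B \<noteq> ?H \<restriction> ?C" by metis
  ultimately show ?thesis by simp
qed

text \<open>Deleting the first block shows that \<open>k\<close> vertices suffice. Fewer deletions
  spare some \<open>w < k\<close>, and then what remains is strongly connected, a single
  component.\<close>

lemma essential_connectivity_extremal:
  assumes "k + n1 + 2 \<le> n" "n1 \<ge> 2"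
  shows "essential_connectivity E = enat k"
  unfolding essential_connectivity_def
proof (rule antisym)
  have kn: "k + n1 \<le> n" using assms by simp
  interpret digraph E by (rule digraph_extremal) fact
  have "verts E - {0..<k} = {k..<n}" using kn by (auto simp: extremal_simps[OF kn])
  then have "{0..<k} \<in> {S. S \<subseteq> verts E \<and> card (nontrivial_sccs (E \<restriction> (verts E - S))) \<ge> 2}"
    using card_nontrivial_sccs_extremal[OF assms] kn by (auto simp: extremal_simps(1)[OF kn])
  from INF_lower[OF this, of "\<lambda>S. enat (card S)"]
  show "(INF S\<in>{S. S \<subseteq> verts E \<and> card (nontrivial_sccs (E \<restriction> (verts E - S))) \<ge> 2}. enat (card S)) \<le> enat k"
    by simp
  show "enat k \<le> (INF S\<in>{S. S \<subseteq> verts E \<and> card (nontrivial_sccs (E \<restriction> (verts E - S))) \<ge> 2}. enat (card S))"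
  proof (rule INF_greatest)
    fix S assume S: "S \<in> {S. S \<subseteq> verts E \<and> card (nontrivial_sccs (E \<restriction> (verts E - S))) \<ge> 2}"
    let ?H = "E \<restriction> (verts E - S)"
    show "enat k \<le> enat (card S)"
    proof (rule ccontr)
      assume "\<not> ?thesis"
      then have "card S < card {0..<k}" by simp
      moreover have "finite S" using S by (auto intro: finite_subset)
      ultimately obtain w where "w < k" "w \<notin> S"
        by (metis atLeastLessThan_iff card_mono linorder_not_less subsetI)
      then have "strongly_connected ?H"
        using kn by (intro strongly_connected_extremal_induce[of w]) (auto simp: extremal_simps(1)[OF kn])
      moreover have "wf_digraph ?H" by (rule wellformed_induce_subgraph)
      ultimately have "pre_digraph.sccs ?H = {?H}"
        by (simp add: wf_digraph.strongly_connected_eq_iff)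
      then have "nontrivial_sccs ?H \<subseteq> {?H}" by (auto simp: nontrivial_sccs_def)
      then have "card (nontrivial_sccs ?H) \<le> card {?H}" by (intro card_mono) auto
      then show False using S by simp
    qed
  qed
qed

lemma extremal_in_essential_class:
  assumes "k \<ge> 1" "k + n1 + 2 \<le> n" "n1 \<ge> 2"
  shows "E \<in> essential_class n k"
  using assms digraph_extremal strongly_connected_extremal essential_connectivity_extremal
  by (simp add: essential_class_def extremal_simps)

text \<open>The digraph attains \<open>cut_dist\<close> with \<open>R\<close> the last block and
  \<open>A\<close> the middle one: the missing arcs are bypassed by two-arc paths through vertex 0,
  which lies in the first block because \<open>k \<ge> 1\<close>.\<close>

lemma distance_spectral_radius_extremal:
  assumes "k \<ge> 1" "k + n1 \<le> n"
  shows "distance_spectral_radius E = quad_root (real n) (real ((n - k - n1) * n1)) - 1"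
proof -
  interpret digraph E by (rule digraph_extremal) fact
  let ?B = "{k..<k + n1}" and ?C = "{k + n1..<n}"
  have "directed_dist E u v \<le> cut_dist ?C ?B u v" if uv: "u \<in> verts E" "v \<in> verts E" for u v
  proof -
    consider "u = v" | "u \<noteq> v" "u \<in> ?C" "v \<in> ?B" | "u \<noteq> v" "u \<rightarrow>\<^bsub>E\<^esub> v"
      using uv by (auto simp: extremal_adj[OF assms(2)] extremal_simps(1)[OF assms(2)])
    then show ?thesis
    proof cases
      case 2
      then have "directed_dist E u v \<le> 2"
        using assms by (intro directed_dist_two[of u 0 v]) (auto simp: extremal_adj)
      then show ?thesis using 2 by (simp add: cut_dist_def)
    next
      case 3
      then show ?thesis using directed_dist_adj[OF 3(2,1)] by (simp add: cut_dist_def)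
    qed (use uv directed_dist_self in \<open>simp add: cut_dist_def\<close>)
  qed
  then have "distance_spectral_radius E
      = quad_root (real (card (verts E))) (real (card ?C * card ?B)) - 1"
    using assms
    by (intro distance_spectral_radius_cut_eq fin_digraph_axioms strongly_connected_extremal)
      (auto simp: extremal_adj extremal_simps)
  then show ?thesis by (simp add: extremal_simps[OF assms(2)] diff_diff_left)
qed

end

theorem theorem3:
  fixes n k :: nat
  assumes "k \<ge> 1" and "n \<ge> k + 4"
  shows "extremal_digraph n k 2 \<in> essential_class n k
    \<and> extremal_digraph n k (n - k - 2) \<in> essential_class n k
    \<and> (\<forall>G \<in> (essential_class n k :: ('a, 'b) pre_digraph set).
          distance_spectral_radius G \<ge> distance_spectral_radius (extremal_digraph n k 2))
    \<and> distance_spectral_radius (extremal_digraph n k 2)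
        = distance_spectral_radius (extremal_digraph n k (n - k - 2))"
proof -
  let ?\<rho> = "quad_root (real n) (real (2 * (n - k - 2))) - 1"
  \<comment> \<open>The choices \<open>n1 = 2\<close> and \<open>n1 = n - k - 2\<close> exchange the
    two block sizes, so the same product occurs. Natural subtraction is harmless here because
    \<open>n \<ge> k + 4\<close>.\<close>
  have "(n - k - (n - k - 2)) * (n - k - 2) = 2 * (n - k - 2)" using assms by simp
  then have "distance_spectral_radius (extremal_digraph n k 2) = ?\<rho>"
    "distance_spectral_radius (extremal_digraph n k (n - k - 2)) = ?\<rho>"
    using assms distance_spectral_radius_extremal[of k 2 n]
      distance_spectral_radius_extremal[of k "n - k - 2" n]
    by (simp_all only: mult.commute[of "n - k - 2" 2]) simp_all
  moreover have "\<forall>G \<in> (essential_class n k :: ('a, 'b) pre_digraph set). ?\<rho> \<le> distance_spectral_radius G"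
    by (intro ballI essential_class_spectral_radius_ge)
  ultimately show ?thesis
    using extremal_in_essential_class[of k 2 n] extremal_in_essential_class[of k "n - k - 2" n] assms
    by (simp only:)
qed

end
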